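(* Let $m$ be a positive integer and let $G$ be a graph with $m$ edges such that $C(G)=C(m)$. Then $\Delta(G)\le 11$.
   Context: Graphs are finite and simple. For a graph $G$, $C(G)$ denotes the number of cycles in $G$ (as subgraphs), and $\Delta(G)$ denotes the maximum degree of $G$. For $m\in\mathbb{Z}^+$, $C(m)$ denotes the maximum of $C(H)$ over all graphs $H$ with exactly $m$ edges (with any number of vertices). *)

theory Defs
  imports Main
begin

type_synonym 'a graph = "'a set \<times> 'a set set"

abbreviation verts :: "'a graph \<Rightarrow> 'a set" where
  "verts G \<equiv> fst G"

abbreviation edges :: "'a graph \<Rightarrow> 'a set set" where
  "edges G \<equiv> snd G"

definition simple_graph :: "'a graph \<Rightarrow> bool" where
  "simple_graph G \<longleftrightarrow>
     finite (verts G) \<and> (\<forall>e \<in> edges G. e \<subseteq> verts G \<and> card e = 2)"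

definition subgraph :: "'a graph \<Rightarrow> 'a graph \<Rightarrow> bool" where
  "subgraph H G \<longleftrightarrow> simple_graph H \<and> verts H \<subseteq> verts G \<and> edges H \<subseteq> edges G"

definition degree :: "'a graph \<Rightarrow> 'a \<Rightarrow> nat" where
  "degree G v = card {e \<in> edges G. v \<in> e}"

text \<open>Meaningful only if there is at least one vertex.\<close>
definition max_degree :: "'a graph \<Rightarrow> nat" where
  "max_degree G = Max (degree G ` verts G)"

definition is_cycle :: "'a graph \<Rightarrow> bool" where
  "is_cycle H \<longleftrightarrow>
     (\<exists>vs. distinct vs \<and> 3 \<le> length vs \<and> verts H = set vs \<and>
           edges H = {{vs ! i, vs ! (Suc i mod length vs)} | i. i < length vs})"

text \<open>Cycles are counted as subgraphs: the starting point and the orientation of a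
  traversal play no role.\<close>
definition cycles :: "'a graph \<Rightarrow> 'a graph set" where
  "cycles G = {H. subgraph H G \<and> is_cycle H}"

definition num_cycles :: "'a graph \<Rightarrow> nat" where
  "num_cycles G = card (cycles G)"

text \<open>Every finite graph is isomorphic to one whose vertices are natural numbers, so the
  maximum over all graphs may be taken over graphs of type \<^typ>\<open>nat graph\<close>. The set is
  finite and nonempty by the lemmas \<open>finite_cycle_counts\<close> and \<open>cycle_counts_nonempty\<close>.\<close>
definition max_num_cycles :: "nat \<Rightarrow> nat" where
  "max_num_cycles m =
     Max {num_cycles H | H :: nat graph. simple_graph H \<and> card (edges H) = m}"

lemma finite_edges: "simple_graph G \<Longrightarrow> finite (edges G)"
  by (rule finite_subset[where B = "Pow (verts G)"]) (auto simp: simple_graph_def)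

lemma is_cycle_verts:
  assumes "is_cycle H"
  shows "verts H = \<Union> (edges H)"
proof -
  obtain vs where vs: "3 \<le> length vs" "verts H = set vs"
      "edges H = {{vs ! i, vs ! (Suc i mod length vs)} | i. i < length vs}"
    using assms unfolding is_cycle_def by blast
  have "Suc i mod length vs < length vs" for i
    using vs(1) by (intro mod_less_divisor) linarith
  then have "x \<in> set vs" if "x \<in> \<Union> (edges H)" for x
    using that vs(3) by auto
  moreover have "x \<in> \<Union> (edges H)" if x: "x \<in> set vs" for x
  proof -
    obtain i where i: "i < length vs" "x = vs ! i"
      using x by (auto simp: in_set_conv_nth)
    have "{vs ! i, vs ! (Suc i mod length vs)} \<in> edges H"
      unfolding vs(3) using i(1) by blast
    then show ?thesis
      using i(2) by blast
  qed
  ultimately show ?thesis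
    unfolding vs(2) by blast
qed

lemma cycles_subset: "cycles G \<subseteq> (\<lambda>F. (\<Union> F, F)) ` Pow (edges G)"
proof
  fix H assume "H \<in> cycles G"
  then have "edges H \<subseteq> edges G" "verts H = \<Union> (edges H)"
    by (simp_all add: cycles_def subgraph_def is_cycle_verts)
  then show "H \<in> (\<lambda>F. (\<Union> F, F)) ` Pow (edges G)"
    by (intro image_eqI[where x = "edges H"]) (simp_all add: prod_eq_iff)
qed

lemma finite_cycles: "simple_graph G \<Longrightarrow> finite (cycles G)"
  by (rule finite_subset[OF cycles_subset]) (simp add: finite_edges)

lemma num_cycles_le:
  assumes "simple_graph G"
  shows "num_cycles G \<le> 2 ^ card (edges G)"
proof -
  have fin: "finite (edges G)"
    using assms by (rule finite_edges)
  then have "num_cycles G \<le> card ((\<lambda>F. (\<Union> F, F)) ` Pow (edges G))"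
    unfolding num_cycles_def by (intro card_mono cycles_subset) auto
  also have "\<dots> \<le> card (Pow (edges G))"
    using fin by (intro card_image_le) auto
  finally show ?thesis
    using fin by (simp add: card_Pow)
qed

lemma finite_cycle_counts:
  "finite {num_cycles H | H :: nat graph. simple_graph H \<and> card (edges H) = m}"
  by (rule finite_subset[where B = "{..2 ^ m}"]) (auto dest: num_cycles_le)

lemma cycle_counts_nonempty:
  "{num_cycles H | H :: nat graph. simple_graph H \<and> card (edges H) = m} \<noteq> {}"
proof -
  let ?S = "({0..m}, (\<lambda>i. {0, i}) ` {1..m}) :: nat graph"
  have "inj_on (\<lambda>i. {0, i}) {1..m}"
    by (auto simp: inj_on_def doubleton_eq_iff)
  then have "simple_graph ?S \<and> card (edges ?S) = m"
    by (auto simp: simple_graph_def card_image)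
  then show ?thesis
    by blast
qed

end

theory Submission
  imports Defs "HOL-Combinatorics.Permutations"
begin

text \<open>A vertex \<open>v\<close> of degree \<open>d \<ge> 12\<close> can be replaced by a copy of \<open>K\<^sub>4\<close>: delete six of the edges
  at \<open>v\<close> (paying for the six edges of \<open>K\<^sub>4\<close>) and distribute the other \<open>d - 6\<close> over the four new
  vertices. Two distinct vertices of \<open>K\<^sub>4\<close> are joined by five paths, so a cycle through \<open>v\<close>
  gives rise to five cycles if its two edges at \<open>v\<close> are sent to different vertices, to one
  if they are sent to the same vertex, and to none if one of them is deleted. For \<open>d = 12\<close>, with two,
  two, one and one edges at the new vertices, these numbers add up to \<open>134\<close> over the
  \<open>12 \<cdot> 11 = 132\<close> ordered pairs of edges at \<open>v\<close>; hence a suitable permutation of the edges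
  loses no cycles through \<open>v\<close>. The cycles inside \<open>K\<^sub>4\<close> make the gain strict.\<close>

section \<open>Cycles as lists\<close>

fun path_edges :: "'a list \<Rightarrow> 'a set set" where
  "path_edges (x # y # zs) = insert {x, y} (path_edges (y # zs))"
| "path_edges _ = {}"

lemma path_edges_Cons: "xs \<noteq> [] \<Longrightarrow> path_edges (x # xs) = insert {x, hd xs} (path_edges xs)"
  by (cases xs) auto

lemma path_edges_append:
  "xs \<noteq> [] \<Longrightarrow> ys \<noteq> [] \<Longrightarrow>
    path_edges (xs @ ys) = path_edges xs \<union> insert {last xs, hd ys} (path_edges ys)"
  by (induction xs rule: path_edges.induct) (auto simp: path_edges_Cons)

lemma path_edges_map: "path_edges (map f xs) = (`) f ` path_edges xs"
  by (induction xs rule: path_edges.induct) auto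

lemma path_edges_subset: "e \<in> path_edges xs \<Longrightarrow> e \<subseteq> set xs"
  by (induction xs rule: path_edges.induct) auto

lemma card_path_edges: "distinct xs \<Longrightarrow> e \<in> path_edges xs \<Longrightarrow> card e = 2"
  by (induction xs rule: path_edges.induct) auto

text \<open>The head of a distinct list lies on no later edge, so the only edge at it reveals the
  second vertex; removing that edge leaves the same claim for the tails. Equal heads exclude
  reversals.\<close>

lemma path_edges_inj:
  assumes "path_edges xs = path_edges ys" "distinct xs" "distinct ys"
    and "xs \<noteq> []" "ys \<noteq> []" "hd xs = hd ys"
  shows "xs = ys"
  using assms
proof (induction xs arbitrary: ys rule: path_edges.induct)
  case (1 x y zs)
  then obtain y' zs' where ys: "ys = x # y' # zs'"
    by (cases ys rule: path_edges.cases) auto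
  have new: "{x, u} \<notin> path_edges us" if "x \<notin> set us" for u us
    using path_edges_subset[of "{x, u}" us] that by auto
  have "{x, y} \<in> insert {x, y'} (path_edges (y' # zs'))"
    using "1.prems"(1) ys by auto
  then have y: "y' = y"
    using new[of "y' # zs'" y] "1.prems"(3) ys by (auto simp: doubleton_eq_iff)
  have "path_edges (y # zs) = path_edges (y # zs')"
    using "1.prems"(1-3) ys y new[of "y # zs" y] new[of "y # zs'" y] by (simp add: insert_ident)
  then show ?case
    using "1.IH"[of "y # zs'"] "1.prems" ys y by auto
next
  case ("2_1" ys)
  then show ?case by simp
next
  case ("2_2" x ys)
  then show ?case by (cases ys rule: path_edges.cases) auto
qed

text \<open>Keeping the closing edge apart from an open path reduces cutting and splicing of cycles
  to \<open>path_edges_append\<close>. Only distinct lists of length at least 3 give a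
  cycle.\<close>

definition closed_edges :: "'a list \<Rightarrow> 'a set set" where
  "closed_edges vs = insert {last vs, hd vs} (path_edges vs)"

lemma path_edges_nth: "path_edges vs = {{vs ! i, vs ! Suc i} | i. Suc i < length vs}"
proof (induction vs rule: path_edges.induct)
  case (1 x y zs)
  have "{{(x # y # zs) ! i, (x # y # zs) ! Suc i} | i. Suc i < length (x # y # zs)} =
      insert {x, y} {{(y # zs) ! i, (y # zs) ! Suc i} | i. Suc i < length (y # zs)}"
    (is "?A = insert _ ?B")
  proof
    show "?A \<subseteq> insert {x, y} ?B"
    proof
      fix e assume "e \<in> ?A"
      then obtain i where "e = {(x # y # zs) ! i, (x # y # zs) ! Suc i}" "Suc i < length (x # y # zs)"
        by blast
      then show "e \<in> insert {x, y} ?B"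
        by (cases i) auto
    qed
    have "{x, y} \<in> ?A" by (intro CollectI exI[of _ 0]) auto
    moreover have "?B \<subseteq> ?A"
    proof
      fix e assume "e \<in> ?B"
      then obtain i where "e = {(y # zs) ! i, (y # zs) ! Suc i}" "Suc i < length (y # zs)"
        by blast
      then show "e \<in> ?A"
        by (intro CollectI exI[of _ "Suc i"]) auto
    qed
    ultimately show "insert {x, y} ?B \<subseteq> ?A" by blast
  qed
  then show ?case using 1 by simp
qed auto

lemma closed_edges_nth:
  assumes "vs \<noteq> []"
  shows "closed_edges vs = {{vs ! i, vs ! (Suc i mod length vs)} | i. i < length vs}" (is "_ = ?A")
proof
  \<comment> \<open>The closing edge belongs to the last index, where the successor wraps around to
    0.\<close>
  have "{last vs, hd vs} \<in> ?A"
    using assms by (intro CollectI exI[of _ "length vs - 1"]) (auto simp: last_conv_nth hd_conv_nth)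
  moreover have "{vs ! i, vs ! Suc i} \<in> ?A" if "Suc i < length vs" for i
    using that by (intro CollectI exI[of _ i]) auto
  ultimately show "closed_edges vs \<subseteq> ?A"
    unfolding closed_edges_def path_edges_nth by blast
next
  show "?A \<subseteq> closed_edges vs"
  proof
    fix e assume "e \<in> ?A"
    then obtain i where i: "i < length vs" "e = {vs ! i, vs ! (Suc i mod length vs)}"
      by blast
    show "e \<in> closed_edges vs"
    proof (cases "Suc i < length vs")
      case True
      then show ?thesis using i unfolding closed_edges_def path_edges_nth by auto
    next
      case False
      then have "length vs = Suc i" using i by simp
      then show ?thesis
        using i assms unfolding closed_edges_def by (auto simp: last_conv_nth hd_conv_nth)
    qed
  qed
qed

lemma is_cycle_iff:
  "is_cycle H \<longleftrightarrow>
    (\<exists>vs. distinct vs \<and> 3 \<le> length vs \<and> verts H = set vs \<and> edges H = closed_edges vs)"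
proof -
  have "edges H = closed_edges vs \<longleftrightarrow>
      edges H = {{vs ! i, vs ! (Suc i mod length vs)} | i. i < length vs}"
    if "3 \<le> length vs" for vs
    using that closed_edges_nth[of vs] by (cases vs) simp_all
  then show ?thesis
    unfolding is_cycle_def by blast
qed

lemma closed_edges_append:
  "xs \<noteq> [] \<Longrightarrow> ys \<noteq> [] \<Longrightarrow> closed_edges (xs @ ys) =
    path_edges xs \<union> path_edges ys \<union> {{hd xs, last ys}, {last xs, hd ys}}"
  by (auto simp: closed_edges_def path_edges_append)

lemma closed_edges_rotate: "closed_edges (xs @ ys) = closed_edges (ys @ xs)"
  by (cases "xs = [] \<or> ys = []") (auto simp: closed_edges_def path_edges_append)

text \<open>Rotating the vertex list brings \<open>v\<close> to the front; the rest is the path that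
  remains when the cycle is opened at \<open>v\<close>.\<close>

lemma cycle_through_vertex:
  assumes "is_cycle H" "v \<in> verts H"
  shows "\<exists>xs. distinct (v # xs) \<and> 2 \<le> length xs \<and> verts H = set (v # xs) \<and>
    edges H = closed_edges (v # xs)"
proof -
  obtain vs where vs: "distinct vs" "3 \<le> length vs" "verts H = set vs" "edges H = closed_edges vs"
    using assms(1) unfolding is_cycle_iff by blast
  obtain as bs where split: "vs = as @ v # bs"
    using assms(2) vs(3) by (metis split_list)
  show ?thesis
    using vs closed_edges_rotate[of as "v # bs"] unfolding split
    by (intro exI[of _ "bs @ as"]) auto
qed

text \<open>Every vertex of a cycle lies on one of its edges, so containment of the edges in
  \<open>G\<close> already yields containment of the vertices.\<close>

lemma closed_list_in_cycles:
  assumes "simple_graph G" "distinct vs" "3 \<le> length vs" "closed_edges vs \<subseteq> edges G"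
  shows "(set vs, closed_edges vs) \<in> cycles G"
proof -
  have cyc: "is_cycle (set vs, closed_edges vs)"
    using assms(2,3) by (auto simp: is_cycle_iff)
  have Un: "set vs = \<Union> (closed_edges vs)"
    using is_cycle_verts[OF cyc] by simp
  also have "\<dots> \<subseteq> verts G"
    using assms(1,4) by (auto simp: simple_graph_def)
  finally have "set vs \<subseteq> verts G" .
  moreover have "e \<subseteq> set vs" "card e = 2" if "e \<in> closed_edges vs" for e
    using assms(1,4) that by (auto simp: Un simple_graph_def)
  ultimately show ?thesis
    using assms(4) cyc by (simp add: cycles_def subgraph_def simple_graph_def)
qed

section \<open>Relabelling vertices\<close>

definition graph_image :: "('a \<Rightarrow> 'b) \<Rightarrow> 'a graph \<Rightarrow> 'b graph" where
  "graph_image f G = (f ` verts G, (`) f ` edges G)"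

lemma simple_graph_image:
  assumes "simple_graph G" "inj_on f (verts G)"
  shows "simple_graph (graph_image f G)"
proof -
  have "card (f ` e) = 2" if "e \<in> edges G" for e
    using that assms card_image[OF inj_on_subset[OF assms(2)], of e]
    by (auto simp: simple_graph_def)
  then show ?thesis
    using assms(1) unfolding simple_graph_def graph_image_def by auto
qed

lemma inj_on_image_edges:
  assumes "simple_graph G" "inj_on f (verts G)"
  shows "inj_on ((`) f) (edges G)"
  using assms by (intro inj_on_image inj_on_subset[OF assms(2)]) (auto simp: simple_graph_def)

lemma cycles_graph_image:
  assumes "inj_on f (verts G)" "H \<in> cycles G"
  shows "graph_image f H \<in> cycles (graph_image f G)"
proof -
  have H: "subgraph H G" "is_cycle H"
    using assms(2) by (auto simp: cycles_def)
  have inj: "inj_on f (verts H)"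
    using assms(1) H(1) by (auto simp: subgraph_def intro: inj_on_subset)
  obtain vs where vs: "distinct vs" "3 \<le> length vs" "verts H = set vs" "edges H = closed_edges vs"
    using H(2) unfolding is_cycle_iff by blast
  have "edges (graph_image f H) = closed_edges (map f vs)"
    using vs(2,4) by (cases "vs = []")
      (auto simp: graph_image_def closed_edges_def path_edges_map last_map hd_map)
  then have "is_cycle (graph_image f H)"
    unfolding is_cycle_iff using vs inj
    by (intro exI[of _ "map f vs"]) (auto simp: graph_image_def distinct_map)
  moreover have "simple_graph (graph_image f H)"
    using H(1) inj by (intro simple_graph_image) (auto simp: subgraph_def)
  ultimately show ?thesis
    using H(1) by (auto simp: cycles_def subgraph_def graph_image_def)
qed

lemma inj_on_graph_image_cycles:
  assumes "simple_graph G" "inj_on f (verts G)"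
  shows "inj_on (graph_image f) (cycles G)"
proof (rule inj_onI)
  fix H K assume HK: "H \<in> cycles G" "K \<in> cycles G" "graph_image f H = graph_image f K"
  then have "verts H = verts K"
    using inj_on_image_eq_iff[OF assms(2), of "verts H" "verts K"]
    by (auto simp: cycles_def subgraph_def graph_image_def)
  moreover have "edges H = edges K"
    using inj_on_image_eq_iff[OF inj_on_image_edges[OF assms], of "edges H" "edges K"] HK
    by (auto simp: cycles_def subgraph_def graph_image_def)
  ultimately show "H = K"
    by (rule prod_eqI)
qed

text \<open>The maximum ranges over graphs on \<open>nat\<close> only. An injection of the finite
  vertex set into \<open>nat\<close> keeps the number of edges and loses no cycle, so the bound
  holds at every type, in particular for the gadget graph on a sum type.\<close>

lemma num_cycles_le_max:
  fixes G :: "'a graph"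
  assumes "simple_graph G"
  shows "num_cycles G \<le> max_num_cycles (card (edges G))"
proof -
  have "finite (verts G)"
    using assms by (simp add: simple_graph_def)
  then obtain f :: "'a \<Rightarrow> nat" where f: "inj_on f (verts G)"
    using finite_imp_inj_to_nat_seg by metis
  let ?H = "graph_image f G"
  have H: "simple_graph ?H"
    using assms f by (rule simple_graph_image)
  have "num_cycles G \<le> num_cycles ?H"
    unfolding num_cycles_def using cycles_graph_image[OF f]
    by (intro card_inj_on_le[OF inj_on_graph_image_cycles[OF assms f]] finite_cycles H) auto
  also have "\<dots> \<le> max_num_cycles (card (edges G))"
    unfolding max_num_cycles_def
    using H card_image[OF inj_on_image_edges[OF assms f]]
    by (intro Max_ge finite_cycle_counts CollectI exI[of _ ?H]) (auto simp: graph_image_def)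
  finally show ?thesis .
qed

section \<open>Averaging over permutations\<close>

text \<open>Permutations act transitively on ordered pairs of distinct elements, and composing with
  a fixed permutation only reorders the sum.\<close>

lemma sum_permutes_pair:
  fixes f :: "'a \<Rightarrow> 'a \<Rightarrow> nat"
  assumes "finite A" "a \<in> A" "b \<in> A" "a \<noteq> b" "c \<in> A" "d \<in> A" "c \<noteq> d"
  shows "(\<Sum>\<sigma> | \<sigma> permutes A. f (\<sigma> a) (\<sigma> b)) = (\<Sum>\<sigma> | \<sigma> permutes A. f (\<sigma> c) (\<sigma> d))"
proof -
  \<comment> \<open>First \<open>a\<close> is moved to \<open>c\<close>, then the image of
    \<open>b\<close> to \<open>d\<close>; the second swap leaves \<open>c\<close> alone because
    neither \<open>\<rho> b\<close> nor \<open>d\<close> equals \<open>c\<close>.\<close>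
  define \<rho> where "\<rho> = transpose a c"
  define \<tau> where "\<tau> = transpose (\<rho> b) d \<circ> \<rho>"
  have \<rho>: "\<rho> permutes A" "\<rho> a = c" "\<rho> b \<noteq> c"
    using assms by (auto simp: \<rho>_def permutes_swap_id transpose_def)
  then have "\<rho> b \<in> A"
    using assms permutes_in_image by metis
  then have \<tau>: "\<tau> permutes A" "\<tau> a = c" "\<tau> b = d"
    using \<rho> assms by (auto simp: \<tau>_def transpose_def intro!: permutes_compose permutes_swap_id)
  have "(\<Sum>\<sigma> | \<sigma> permutes A. f (\<sigma> c) (\<sigma> d)) =
      (\<Sum>\<sigma> | \<sigma> permutes A. f ((\<sigma> \<circ> \<tau>) a) ((\<sigma> \<circ> \<tau>) b))"
    using \<tau> by simp
  also have "\<dots> = (\<Sum>\<sigma> | \<sigma> permutes A. f (\<sigma> a) (\<sigma> b))"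
    by (rule sum_permutations_compose_right[OF \<tau>(1), symmetric])
  finally show ?thesis by simp
qed

lemma sum_distinct_pairs_permutes:
  fixes f :: "'a \<Rightarrow> 'a \<Rightarrow> nat"
  assumes "\<sigma> permutes A"
  shows "(\<Sum>(i, j) | i \<in> A \<and> j \<in> A \<and> i \<noteq> j. f (\<sigma> i) (\<sigma> j)) =
    (\<Sum>(i, j) | i \<in> A \<and> j \<in> A \<and> i \<noteq> j. f i j)"
proof -
  have inj: "inj \<sigma>" using assms by (rule permutes_inj)
  have "bij_betw (map_prod \<sigma> \<sigma>) {(i, j). i \<in> A \<and> j \<in> A \<and> i \<noteq> j} {(i, j). i \<in> A \<and> j \<in> A \<and> i \<noteq> j}"
    unfolding bij_betw_def
  proof
    show "inj_on (map_prod \<sigma> \<sigma>) {(i, j). i \<in> A \<and> j \<in> A \<and> i \<noteq> j}"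
      using inj by (auto simp: inj_on_def)
    show "map_prod \<sigma> \<sigma> ` {(i, j). i \<in> A \<and> j \<in> A \<and> i \<noteq> j} = {(i, j). i \<in> A \<and> j \<in> A \<and> i \<noteq> j}"
    proof (intro equalityI subsetI)
      fix p assume "p \<in> {(i, j). i \<in> A \<and> j \<in> A \<and> i \<noteq> j}"
      then obtain i j where "p = (\<sigma> i, \<sigma> j)" "i \<in> A" "j \<in> A" "\<sigma> i \<noteq> \<sigma> j"
        using permutes_image[OF assms] by (auto simp: set_eq_iff image_iff) metis
      then show "p \<in> map_prod \<sigma> \<sigma> ` {(i, j). i \<in> A \<and> j \<in> A \<and> i \<noteq> j}"
        by (intro image_eqI[of _ _ "(i, j)"]) auto
    qed (use inj permutes_in_image[OF assms] in \<open>auto simp: inj_eq\<close>)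
  qed
  from sum.reindex_bij_betw[OF this, of "\<lambda>(i, j). f i j"] show ?thesis
    by (simp add: case_prod_beta map_prod_def)
qed

lemma card_distinct_pairs:
  assumes "finite A"
  shows "card {(i, j). i \<in> A \<and> j \<in> A \<and> i \<noteq> j} = card A * (card A - 1)"
proof -
  have "{(i, j). i \<in> A \<and> j \<in> A \<and> i \<noteq> j} = (SIGMA i:A. A - {i})" by auto
  then show ?thesis using assms by simp
qed

text \<open>First moment argument: \<open>f\<close> has average at least 1 over ordered pairs, and a
  random permutation sends each pair \<open>(a s, b s)\<close> to a uniformly random one. The
  expected sum is thus at least \<open>card S\<close>, and some permutation attains this.\<close>

lemma ex_permutation_sum_ge:
  fixes f :: "'a \<Rightarrow> 'a \<Rightarrow> nat"
  assumes A: "finite A"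
    and f: "card A * (card A - 1) \<le> (\<Sum>(i, j) | i \<in> A \<and> j \<in> A \<and> i \<noteq> j. f i j)"
    and S: "\<And>s. s \<in> S \<Longrightarrow> a s \<in> A \<and> b s \<in> A \<and> a s \<noteq> b s"
  shows "\<exists>\<sigma>. \<sigma> permutes A \<and> card S \<le> (\<Sum>s\<in>S. f (\<sigma> (a s)) (\<sigma> (b s)))"
proof (rule ccontr)
  let ?P = "{\<sigma>. \<sigma> permutes A}" and ?D = "{(i, j). i \<in> A \<and> j \<in> A \<and> i \<noteq> j}"
  assume neg: "\<not> ?thesis"
  have finP: "finite ?P"
    using A by (rule finite_permutations)
  have neP: "?P \<noteq> {}"
    using permutes_id by blast
  \<comment> \<open>The sum over permutations is the same for all pairs, so \<open>card ?D\<close>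
    times it is a double sum; exchanging the order leaves \<open>card ?P\<close> copies of the sum
    of \<open>f\<close>.\<close>
  have each: "card ?P \<le> (\<Sum>\<sigma>\<in>?P. f (\<sigma> x) (\<sigma> y))" if xy: "x \<in> A" "y \<in> A" "x \<noteq> y" for x y
  proof -
    have "card ?D * (\<Sum>\<sigma>\<in>?P. f (\<sigma> x) (\<sigma> y)) = (\<Sum>(i, j)\<in>?D. \<Sum>\<sigma>\<in>?P. f (\<sigma> x) (\<sigma> y))"
      by simp
    also have "\<dots> = (\<Sum>(i, j)\<in>?D. \<Sum>\<sigma>\<in>?P. f (\<sigma> i) (\<sigma> j))"
      using sum_permutes_pair[OF A xy] by (intro sum.cong) auto
    also have "\<dots> = (\<Sum>\<sigma>\<in>?P. \<Sum>(i, j)\<in>?D. f (\<sigma> i) (\<sigma> j))"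
      unfolding case_prod_beta by (rule sum.swap)
    also have "\<dots> = (\<Sum>\<sigma>\<in>?P. \<Sum>(i, j)\<in>?D. f i j)"
      by (rule sum.cong[OF refl]) (simp only: mem_Collect_eq sum_distinct_pairs_permutes)
    also have "\<dots> = card ?P * (\<Sum>(i, j)\<in>?D. f i j)"
      by simp
    also have "\<dots> \<ge> card ?P * card ?D"
      using f card_distinct_pairs[OF A] by (intro mult_left_mono) auto
    finally have "card ?D * card ?P \<le> card ?D * (\<Sum>\<sigma>\<in>?P. f (\<sigma> x) (\<sigma> y))"
      by (simp add: mult.commute)
    moreover have "0 < card ?D"
    proof -
      have "finite ?D" by (rule finite_subset[of _ "A \<times> A"]) (use A in auto)
      then show ?thesis using xy by (auto simp: card_gt_0_iff)
    qed
    ultimately show ?thesis by simp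
  qed
  \<comment> \<open>Double counting: each \<open>s\<close> contributes at least
    \<open>card ?P\<close> in total, whereas by \<open>neg\<close> every permutation yields less
    than \<open>card S\<close>.\<close>
  have "card ?P * card S = (\<Sum>s\<in>S. card ?P)"
    by simp
  also have "\<dots> \<le> (\<Sum>s\<in>S. \<Sum>\<sigma>\<in>?P. f (\<sigma> (a s)) (\<sigma> (b s)))"
    using S by (intro sum_mono each) auto
  also have "\<dots> = (\<Sum>\<sigma>\<in>?P. \<Sum>s\<in>S. f (\<sigma> (a s)) (\<sigma> (b s)))"
    by (rule sum.swap)
  also have "\<dots> < (\<Sum>\<sigma>\<in>?P. card S)"
    using neg finP neP by (intro sum_strict_mono) (auto simp: not_le)
  finally show False by simp
qed

section \<open>The gadget\<close>

text \<open>Labels \<open>0\<close> to \<open>3\<close> name the vertices of \<open>K\<^sub>4\<close>; label \<open>4\<close> marks the deleted edges.\<close>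

definition label :: "nat \<Rightarrow> nat" where
  "label i = (if i < 12 then [0, 0, 1, 1, 2, 3, 4, 4, 4, 4, 4, 4] ! i else 0)"

text \<open>The number of paths in \<open>K4\<close> from \<open>s\<close> to \<open>t\<close>: the
  trivial one if \<open>s = t\<close>, otherwise one with one edge, two with two edges and two with
  three. A deleted edge allows none.\<close>

definition weight :: "nat \<Rightarrow> nat \<Rightarrow> nat" where
  "weight s t = (if s < 4 \<and> t < 4 then if s = t then 1 else 5 else 0)"

lemma weight_commute: "weight s t = weight t s"
  by (auto simp: weight_def)

text \<open>Among the first twelve indices two have label 0 and four have another kept label, giving
  2 + 4 * 5 = 22. Every later index has label 0 and adds 1.\<close>

lemma sum_weight_zero:
  "12 \<le> d \<Longrightarrow> (\<Sum>j<d. weight (label j) 0) = d + 10"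
proof (induction d rule: dec_induct)
  case base
  show ?case by (simp add: lessThan_nat_numeral weight_def label_def)
next
  case (step d)
  then show ?case by (simp add: weight_def label_def)
qed

text \<open>This is the averaging hypothesis for the labels. It holds with 134 against 132 at
  \<open>d = 12\<close>; from \<open>d\<close> to \<open>d + 1\<close> the left side grows by
  \<open>2 * d\<close>, the right side by \<open>2 * (d + 10)\<close>.\<close>

lemma sum_weight_ge:
  assumes "12 \<le> d"
  shows "d * (d - 1) \<le> (\<Sum>(i, j) | i \<in> {..<d} \<and> j \<in> {..<d} \<and> i \<noteq> j. weight (label i) (label j))"
    (is "_ \<le> ?W d")
proof -
  let ?D = "\<lambda>d. {(i, j). i \<in> {..<d} \<and> j \<in> {..<d} \<and> i \<noteq> j} :: (nat \<times> nat) set"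
  have fin: "finite (?D d)" for d
    by (rule finite_subset[of _ "{..<d} \<times> {..<d}"]) auto
  \<comment> \<open>The new pairs are \<open>(j, d)\<close> and \<open>(d, j)\<close> with
    \<open>j < d\<close>, and \<open>weight\<close> is symmetric.\<close>
  have Suc: "?W (Suc d) = ?W d + 2 * (\<Sum>j<d. weight (label j) (label d))" for d
  proof -
    have split: "?D (Suc d) = ?D d \<union> ((\<lambda>j. (j, d)) ` {..<d} \<union> (\<lambda>j. (d, j)) ` {..<d})"
      by (auto simp: less_Suc_eq)
    have "?W (Suc d) = ?W d + ((\<Sum>(i, j)\<in>(\<lambda>j. (j, d)) ` {..<d}. weight (label i) (label j)) +
        (\<Sum>(i, j)\<in>(\<lambda>j. (d, j)) ` {..<d}. weight (label i) (label j)))"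
      unfolding split using fin by (subst sum.union_disjoint | force)+
    also have "\<dots> = ?W d + 2 * (\<Sum>j<d. weight (label j) (label d))"
      by (simp add: sum.reindex inj_on_def weight_commute[of "label d"])
    finally show ?thesis .
  qed
  have "?W d = 2 * (\<Sum>k<d. \<Sum>j<k. weight (label j) (label k))" for d
    by (induction d) (simp_all only: Suc sum.lessThan_Suc distrib_left, simp)
  \<comment> \<open>Of the 30 ordered pairs among the six kept indices, 4 share a label and weigh 1;
    the other 26 weigh 5.\<close>
  from this[of 12] have "?W 12 = 134"
    by (simp add: lessThan_nat_numeral weight_def label_def)
  from assms show ?thesis
  proof (induction d rule: dec_induct)
    case base
    show ?case using \<open>?W 12 = 134\<close> by simp
  next
    case (step d)
    have "label d = 0" using step by (simp add: label_def)
    then have "?W (Suc d) = ?W d + 2 * (d + 10)"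
      using Suc[of d] sum_weight_zero[OF step(1)] by simp
    moreover have "Suc d * (Suc d - 1) = d * (d - 1) + 2 * d"
      using step(1) by (cases d) (auto simp: algebra_simps)
    moreover have "d * (d - 1) + 2 * d \<le> ?W d + 2 * (d + 10)"
      using step.IH by (intro add_mono) auto
    ultimately show ?case by (simp only:)
  qed
qed

lemma card_label_lt_4:
  "12 \<le> d \<Longrightarrow> card {i. i < d \<and> label i < 4} = d - 6"
proof (induction d rule: dec_induct)
  case base
  have "{i. i < 12 \<and> label i < 4} = {..<6}"
  proof -
    have "\<forall>i\<in>{..<12}. label i < 4 \<longleftrightarrow> i < 6"
      by (simp add: lessThan_nat_numeral label_def)
    then show ?thesis by auto
  qed
  then show ?case by simp
next
  case (step d)
  have "{i. i < Suc d \<and> label i < 4} = insert d {i. i < d \<and> label i < 4}"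
    using step(1) by (auto simp: less_Suc_eq label_def)
  then show ?case using step by simp
qed

text \<open>Since \<open>K4\<close> is complete, every nonempty distinct list of its vertices is a
  path. One-vertex lists are included, for cycles that enter and leave the gadget at the same
  vertex.\<close>

definition K4_paths :: "nat \<Rightarrow> nat \<Rightarrow> nat list set" where
  "K4_paths s t = {q. q \<noteq> [] \<and> distinct q \<and> set q \<subseteq> {..<4} \<and> hd q = s \<and> last q = t}"

lemma finite_K4_paths: "finite (K4_paths s t)"
  by (rule finite_subset[OF _ finite_subset_distinct[of "{..<4}"]]) (auto simp: K4_paths_def)

lemma weight_le_card_K4_paths: "weight s t \<le> card (K4_paths s t)"
proof -
  consider "\<not> (s < 4 \<and> t < 4)" | "s = t" "s < 4" | "s < 4" "t < 4" "s \<noteq> t" by blast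
  then show ?thesis
  proof cases
    case 2
    then have "{[s]} \<subseteq> K4_paths s t" by (auto simp: K4_paths_def)
    from card_mono[OF finite_K4_paths this] 2 show ?thesis by (simp add: weight_def)
  next
    case 3
    then have "card ({..<4} - {s, t}) = 2"
      by (simp add: card_Diff_subset)
    then obtain x y where *: "{..<4} - {s, t} = {x, y}" "x \<noteq> y"
      by (auto simp: card_2_iff)
    then have "{x, y} \<subseteq> {..<4} - {s, t}"
      by simp
    then have "x < 4" "y < 4" and xy: "distinct [s, t, x, y]"
      using 3 *(2) by auto
    \<comment> \<open>A path from \<open>s\<close> to \<open>t\<close> passes through none, one or
      both of the other two vertices, the latter in either order.\<close>
    then have "{[s, t], [s, x, t], [s, y, t], [s, x, y, t], [s, y, x, t]} \<subseteq> K4_paths s t"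
      using 3 by (auto simp: K4_paths_def)
    from card_mono[OF finite_K4_paths this] 3 xy show ?thesis by (simp add: weight_def)
  qed (auto simp: weight_def)
qed

section \<open>Replacing a vertex by \<open>K4\<close> with the same number of edges\<close>

text \<open>The sum type keeps old and new vertices apart. The edge from \<open>u\<close> to
  \<open>v\<close> is reattached at the gadget vertex \<open>\<phi> u\<close>, or dropped if this
  value is at least 4.\<close>

definition replace_K4 :: "'a \<Rightarrow> ('a \<Rightarrow> nat) \<Rightarrow> 'a graph \<Rightarrow> ('a + nat) graph" where
  "replace_K4 v \<phi> G =
     (Inl ` (verts G - {v}) \<union> Inr ` {..<4},
      (`) Inl ` {e \<in> edges G. v \<notin> e} \<union>
      (\<lambda>u. {Inl u, Inr (\<phi> u)}) ` {u. {u, v} \<in> edges G \<and> \<phi> u < 4} \<union>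
      (`) Inr ` {e. e \<subseteq> {..<4} \<and> card e = 2})"

lemma simple_replace_K4:
  assumes "simple_graph G"
  shows "simple_graph (replace_K4 v \<phi> G)"
proof -
  have loop: "{v} \<notin> edges G"
    using assms by (auto simp: simple_graph_def)
  then have "u \<in> verts G - {v}" if "{u, v} \<in> edges G" for u
    using assms that by (auto simp: simple_graph_def)
  moreover have "e \<subseteq> verts G - {v}" if "e \<in> edges G" "v \<notin> e" for e
    using assms that by (auto simp: simple_graph_def)
  ultimately show ?thesis
    using assms unfolding simple_graph_def replace_K4_def
    by (auto simp: card_image intro!: imageI)
qed

text \<open>The edges at \<open>v\<close> are exchanged for the kept ones and the 6 edges of
  \<open>K4\<close>, which \<open>kept\<close> balances.\<close>

lemma card_edges_replace_K4:
  assumes G: "simple_graph G"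
    and kept: "card {u. {u, v} \<in> edges G \<and> \<phi> u < 4} + 6 = degree G v"
  shows "card (edges (replace_K4 v \<phi> G)) = card (edges G)"
proof -
  let ?A = "(`) Inl ` {e \<in> edges G. v \<notin> e} :: ('a + nat) set set"
  let ?B = "(\<lambda>u. {Inl u, Inr (\<phi> u)}) ` {u. {u, v} \<in> edges G \<and> \<phi> u < 4}"
  let ?C = "(`) Inr ` {e :: nat set. e \<subseteq> {..<4} \<and> card e = 2} :: ('a + nat) set set"
  have fin: "finite (edges G)"
    using G by (rule finite_edges)
  have "finite (edges (replace_K4 v \<phi> G))"
    using G by (intro finite_edges simple_replace_K4)
  then have finABC: "finite ?A" "finite ?B" "finite ?C"
    by (auto simp: replace_K4_def)
  have disj: "?A \<inter> ?B = {}" "(?A \<union> ?B) \<inter> ?C = {}"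
  proof -
    show "?A \<inter> ?B = {}" by auto
    \<comment> \<open>An \<open>Inl\<close> image and an \<open>Inr\<close> image can coincide only
      if both are empty.\<close>
    have "{} \<notin> ?C" by auto
    then show "(?A \<union> ?B) \<inter> ?C = {}" by auto
  qed
  have inj: "inj_on ((`) Inl) X" "inj_on ((`) Inr) Y" for X :: "'a set set" and Y :: "nat set set"
    by (auto simp: inj_on_def inj_image_eq_iff)
  have C: "card ?C = 6"
    using n_subsets[of "{..<4::nat}" 2] by (simp add: card_image inj choose_two)
  have B: "card ?B = card {u. {u, v} \<in> edges G \<and> \<phi> u < 4}"
    by (rule card_image) (auto simp: inj_on_def doubleton_eq_iff)
  have "edges G = {e \<in> edges G. v \<notin> e} \<union> {e \<in> edges G. v \<in> e}" by blast
  then have "card (edges G) = card {e \<in> edges G. v \<notin> e} + degree G v"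
    unfolding degree_def using fin by (subst card_Un_disjoint[symmetric]) auto
  moreover have "card (edges (replace_K4 v \<phi> G)) = card ?A + card ?B + card ?C"
    using finABC disj by (simp add: replace_K4_def card_Un_disjoint)
  ultimately show ?thesis
    using kept B C by (simp add: card_image inj)
qed

section \<open>Rerouting cycles through the gadget\<close>

text \<open>The path \<open>xs\<close> is the cycle opened at \<open>v\<close>, and its ends are the
  neighbours of \<open>v\<close> on the cycle. Its reversal traverses the same cycle, so a choice of
  orientation has to be made later.\<close>

definition traverses :: "'a \<Rightarrow> 'a list \<Rightarrow> 'a graph \<Rightarrow> bool" where
  "traverses v xs H \<longleftrightarrow> distinct (v # xs) \<and> 2 \<le> length xs \<and>
     verts H = set (v # xs) \<and> edges H = closed_edges (v # xs)"

lemma traverses_edges: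
  "traverses v xs H \<Longrightarrow> edges H = path_edges xs \<union> {{hd xs, v}, {last xs, v}}"
  by (cases xs) (auto simp: traverses_def closed_edges_def insert_commute)

text \<open>The path \<open>q\<close> takes the place of \<open>v\<close>. It is entered from
  \<open>last xs\<close> and left towards \<open>hd xs\<close>, which fixes the order of the
  arguments of \<open>K4_paths\<close> below.\<close>

definition detour :: "'a list \<Rightarrow> nat list \<Rightarrow> ('a + nat) graph" where
  "detour xs q = (set (map Inl xs @ map Inr q), closed_edges (map Inl xs @ map Inr q))"

lemma edges_detour:
  "xs \<noteq> [] \<Longrightarrow> q \<noteq> [] \<Longrightarrow> edges (detour xs q) =
    (`) Inl ` path_edges xs \<union> (`) Inr ` path_edges q \<union>
    {{Inl (hd xs), Inr (last q)}, {Inl (last xs), Inr (hd q)}}"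
  by (simp add: detour_def closed_edges_append path_edges_map hd_map last_map)

lemma detour_in_cycles:
  assumes G: "simple_graph G" and H: "H \<in> cycles G" "traverses v xs H"
    and q: "q \<in> K4_paths (\<phi> (last xs)) (\<phi> (hd xs))"
  shows "detour xs q \<in> cycles (replace_K4 v \<phi> G)"
proof -
  have xs: "xs \<noteq> []" "distinct xs" "v \<notin> set xs" "2 \<le> length xs"
    using H(2) by (auto simp: traverses_def)
  have q': "q \<noteq> []" "distinct q" "set q \<subseteq> {..<4}" "hd q = \<phi> (last xs)" "last q = \<phi> (hd xs)"
    using q by (auto simp: K4_paths_def)
  \<comment> \<open>The ends of \<open>q\<close> are vertices of \<open>K4\<close>, so neither edge
    of \<open>H\<close> at \<open>v\<close> has been deleted.\<close>
  then have lt: "\<phi> (last xs) < 4" "\<phi> (hd xs) < 4"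
    using hd_in_set[of q] last_in_set[of q] by auto
  have "edges H \<subseteq> edges G"
    using H(1) by (auto simp: cycles_def subgraph_def)
  then have edges: "path_edges xs \<subseteq> edges G" "{hd xs, v} \<in> edges G" "{last xs, v} \<in> edges G"
    using traverses_edges[OF H(2)] by auto
  have "path_edges xs \<subseteq> {e \<in> edges G. v \<notin> e}"
    using edges(1) path_edges_subset[of _ xs] xs(3) by blast
  moreover have "path_edges q \<subseteq> {e. e \<subseteq> {..<4} \<and> card e = 2}"
    using path_edges_subset[of _ q] card_path_edges[OF q'(2)] q'(3) by blast
  ultimately have "edges (detour xs q) \<subseteq> edges (replace_K4 v \<phi> G)"
    unfolding edges_detour[OF xs(1) q'(1)] replace_K4_def using edges(2,3) lt q'(4,5) by auto
  \<comment> \<open>With the two or more vertices of \<open>xs\<close> this reaches the minimal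
    cycle length 3.\<close>
  moreover have "1 \<le> length q"
    using q'(1) by (cases q) auto
  ultimately show ?thesis
    using xs q' unfolding detour_def
    by (intro closed_list_in_cycles simple_replace_K4 G) (auto simp: distinct_map inj_on_def)
qed

text \<open>Contracting the gadget to \<open>v\<close> recovers the original cycle.\<close>

lemma detour_eqD:
  assumes eq: "detour xs q = detour xs' q'"
    and H: "traverses v xs H" "traverses v xs' H'"
    and q: "q \<noteq> []" "distinct q" "q' \<noteq> []" "distinct q'"
  shows "H = H'" "path_edges q = path_edges q'"
proof -
  \<comment> \<open>The three kinds of edges are read off separately: old edges give the path
    outside, inner edges the path in \<open>K4\<close>, and crossing edges the ends of the outer
    path.\<close>
  have inl: "Inl ` e \<in> edges (detour ys p) \<longleftrightarrow> e \<in> path_edges ys"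
    and inr: "Inr ` f \<in> edges (detour ys p) \<longleftrightarrow> f \<in> path_edges p"
    and cross: "(\<exists>k. {Inl u, Inr k} \<in> edges (detour ys p)) \<longleftrightarrow> u = hd ys \<or> u = last ys"
    if "ys \<noteq> []" "p \<noteq> []" "distinct ys" "distinct p"
    for e f u and ys :: "'a list" and p :: "nat list"
  proof -
    have ne: "{} \<notin> path_edges ys" "{} \<notin> path_edges p"
      using card_path_edges[of ys "{}"] card_path_edges[of p "{}"] that by auto
    have mixed: "Inl ` X = Inr ` Y \<longleftrightarrow> X = {} \<and> Y = {}"
      "Inr ` Y = Inl ` X \<longleftrightarrow> X = {} \<and> Y = {}"
      "Inl ` X \<noteq> {Inl x, Inr y}" "{Inl x, Inr y} \<noteq> Inl ` X"
      "Inr ` Y \<noteq> {Inl x, Inr y}" "{Inl x, Inr y} \<noteq> Inr ` Y"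
      for X :: "'a set" and Y :: "nat set" and x y
      by blast+
    show "Inl ` e \<in> edges (detour ys p) \<longleftrightarrow> e \<in> path_edges ys"
      using ne unfolding edges_detour[OF that(1,2)]
      by (auto simp: inj_image_eq_iff mixed)
    show "Inr ` f \<in> edges (detour ys p) \<longleftrightarrow> f \<in> path_edges p"
      using ne unfolding edges_detour[OF that(1,2)]
      by (auto simp: inj_image_eq_iff mixed)
    show "(\<exists>k. {Inl u, Inr k} \<in> edges (detour ys p)) \<longleftrightarrow> u = hd ys \<or> u = last ys"
      unfolding edges_detour[OF that(1,2)]
      by (auto simp: doubleton_eq_iff mixed)
  qed
  have xs: "xs \<noteq> []" "distinct xs" "xs' \<noteq> []" "distinct xs'"
    using H by (auto simp: traverses_def)
  note rules = inl[OF xs(1) q(1) xs(2) q(2)] inl[OF xs(3) q(3) xs(4) q(4)]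
    inr[OF xs(1) q(1) xs(2) q(2)] inr[OF xs(3) q(3) xs(4) q(4)]
    cross[OF xs(1) q(1) xs(2) q(2)] cross[OF xs(3) q(3) xs(4) q(4)]
  have "path_edges xs = path_edges xs'"
    using rules(1,2) eq by auto
  \<comment> \<open>Only the unordered pair of ends is recovered; this suffices because the edges of
    \<open>H\<close> at \<open>v\<close> do not depend on the orientation.\<close>
  moreover have "{hd xs, last xs} = {hd xs', last xs'}"
    using rules(5,6) eq by auto
  then have "{{hd xs, v}, {last xs, v}} = {{hd xs', v}, {last xs', v}}"
    by (auto simp: doubleton_eq_iff)
  ultimately have "edges H = edges H'"
    using traverses_edges H by metis
  moreover have "verts K = \<Union> (edges K)" if "traverses v ys K" for K ys
    using that unfolding traverses_def
    by (intro is_cycle_verts) (auto simp: is_cycle_iff simp del: distinct.simps intro!: exI[of _ "v # ys"])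
  then have "verts H = \<Union> (edges H)" "verts H' = \<Union> (edges H')"
    using H by blast+
  ultimately show "H = H'"
    by (simp add: prod_eq_iff)
  show "path_edges q = path_edges q'"
    using rules(3,4) eq by auto
qed

text \<open>Three disjoint families of cycles are exhibited: copies of the cycles avoiding
  \<open>v\<close>, the detours, and one triangle inside \<open>K4\<close>, which makes the
  inequality strict.\<close>

lemma num_cycles_replace_K4:
  assumes G: "simple_graph G"
    and rep: "\<And>H. H \<in> cycles G \<Longrightarrow> v \<in> verts H \<Longrightarrow> traverses v (rep H) H"
  shows "card {H \<in> cycles G. v \<notin> verts H} +
      (\<Sum>H | H \<in> cycles G \<and> v \<in> verts H. card (K4_paths (\<phi> (last (rep H))) (\<phi> (hd (rep H)))))
    < num_cycles (replace_K4 v \<phi> G)"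
proof -
  let ?G' = "replace_K4 v \<phi> G"
  let ?U = "{H \<in> cycles G. v \<notin> verts H}" and ?V = "{H \<in> cycles G. v \<in> verts H}"
  let ?Q = "\<lambda>H. K4_paths (\<phi> (last (rep H))) (\<phi> (hd (rep H)))"
  let ?A = "graph_image Inl ` ?U :: ('a + nat) graph set"
  let ?B = "(\<lambda>(H, q). detour (rep H) q) ` (SIGMA H:?V. ?Q H)"
  let ?t = "map Inr [0, 1, 2::nat] :: ('a + nat) list"
  let ?T = "(set ?t, closed_edges ?t)"
  have G': "simple_graph ?G'"
    using G by (rule simple_replace_K4)
  have fin: "finite (cycles G)" "finite (cycles ?G')"
    using G G' by (auto intro: finite_cycles)
  have "?A \<subseteq> cycles ?G'"
  proof (rule image_subsetI)
    fix H assume "H \<in> ?U"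
    then have H: "H \<in> cycles G" "v \<notin> verts H" by simp_all
    have "inj_on Inl (verts G)" by simp
    from cycles_graph_image[OF this H(1)] have "is_cycle (graph_image Inl H :: ('a + nat) graph)"
      "simple_graph (graph_image Inl H :: ('a + nat) graph)"
      by (auto simp: cycles_def subgraph_def)
    moreover have "subgraph H G" using H(1) by (simp add: cycles_def)
    then have "edges H \<subseteq> {e \<in> edges G. v \<notin> e}" "verts H \<subseteq> verts G - {v}"
      using H(2) by (auto simp: subgraph_def simple_graph_def)
    ultimately show "graph_image Inl H \<in> cycles ?G'"
      unfolding cycles_def subgraph_def graph_image_def replace_K4_def by auto
  qed
  moreover have "?B \<subseteq> cycles ?G'"
    using detour_in_cycles[OF G] rep by auto
  moreover have "?T \<in> cycles ?G'"
  proof (rule closed_list_in_cycles[OF G'])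
    have "closed_edges ?t = (`) Inr ` {{0, 1}, {1, 2}, {2, 0}}"
      by (auto simp: closed_edges_def)
    also have "\<dots> \<subseteq> (`) Inr ` {e. e \<subseteq> {..<4::nat} \<and> card e = 2}"
      by (rule image_mono) auto
    also have "\<dots> \<subseteq> edges ?G'"
      by (simp add: replace_K4_def)
    finally show "closed_edges ?t \<subseteq> edges ?G'" .
  qed (auto simp: distinct_map)
  ultimately have "insert ?T (?A \<union> ?B) \<subseteq> cycles ?G'"
    by (simp only: insert_subset Un_subset_iff simp_thms)
  then have "card (insert ?T (?A \<union> ?B)) \<le> num_cycles ?G'"
    unfolding num_cycles_def by (rule card_mono[OF fin(2)])
  moreover have "card (insert ?T (?A \<union> ?B)) = Suc (card ?A + card ?B)"
  proof -
    \<comment> \<open>The families are told apart by their vertices: only old ones in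
      \<open>?A\<close>, both sorts in \<open>?B\<close>, only new ones in
      \<open>?T\<close>.\<close>
    have A: "\<exists>x. Inl x \<in> verts K" "Inr y \<notin> verts K" if A: "K \<in> ?A" for K and y :: nat
    proof -
      obtain H where H: "H \<in> cycles G" "K = graph_image Inl H"
        using A by blast
      then have "verts H \<noteq> {}"
        by (force simp: cycles_def is_cycle_iff)
      then show "\<exists>x. Inl x \<in> verts K" "Inr y \<notin> verts K"
        using H(2) by (auto simp: graph_image_def)
    qed
    have B: "\<exists>x. Inl x \<in> verts K" "\<exists>y. Inr y \<in> verts K" if B: "K \<in> ?B" for K
    proof -
      obtain H q where H: "H \<in> cycles G" "v \<in> verts H" "q \<in> ?Q H" "K = detour (rep H) q"
        using B by auto
      have "rep H \<noteq> []" "q \<noteq> []"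
        using rep[OF H(1,2)] H(3) by (auto simp: traverses_def K4_paths_def)
      then show "\<exists>x. Inl x \<in> verts K" "\<exists>y. Inr y \<in> verts K"
        using H(4) by (auto simp: detour_def neq_Nil_conv)
    qed
    have "Inl x \<notin> verts ?T" for x by auto
    then have "?T \<notin> ?A \<union> ?B"
      using A(1)[of ?T] B(1)[of ?T] by (simp only: Un_iff) metis
    moreover have "?A \<inter> ?B = {}"
      using A(2) B(2) by blast
    moreover have "finite ?A" "finite ?B"
      using fin by (auto intro!: finite_imageI finite_SigmaI finite_K4_paths)
    ultimately show ?thesis
      by (simp only: card_insert_disjoint card_Un_disjoint finite_UnI simp_thms)
  qed
  moreover have "card ?A = card ?U"
    by (intro card_image inj_on_subset[OF inj_on_graph_image_cycles[OF G]]) auto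
  moreover have "inj_on (\<lambda>(H, q). detour (rep H) q) (SIGMA H:?V. ?Q H)"
  proof (rule inj_onI, clarify)
    fix H q H' q'
    assume H: "H \<in> cycles G" "v \<in> verts H" "q \<in> ?Q H"
      and H': "H' \<in> cycles G" "v \<in> verts H'" "q' \<in> ?Q H'"
      and eq: "detour (rep H) q = detour (rep H') q'"
    have q: "q \<noteq> []" "distinct q" "q' \<noteq> []" "distinct q'"
      using H(3) H'(3) by (auto simp: K4_paths_def)
    \<comment> \<open>Equal detours come from the same cycle, hence from the same representative;
      then \<open>q\<close> and \<open>q'\<close> start at the same vertex, and their equal edge
      sets determine them.\<close>
    note D = detour_eqD[OF eq rep[OF H(1,2)] rep[OF H'(1,2)] q]
    have "hd q = hd q'"
      using H(3) H'(3) D(1) by (auto simp: K4_paths_def)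
    then show "H = H' \<and> q = q'"
      using D q path_edges_inj by blast
  qed
  then have "card ?B = (\<Sum>H\<in>?V. card (?Q H))"
    using fin by (simp add: card_image card_SigmaI finite_K4_paths)
  ultimately show ?thesis
    by linarith
qed

section \<open>Gaining cycles at a vertex of large degree, and the degree bound\<close>

text \<open>Averaging is applied to the pairs of neighbours of \<open>v\<close> on the cycles
  through \<open>v\<close>, numbered by \<open>idx\<close>. The permutation found makes the total
  weight of these cycles at least their number, and the triangle in the gadget adds one
  more.\<close>

lemma ex_more_cycles:
  fixes G :: "'a graph"
  assumes G: "simple_graph G" and d: "12 \<le> degree G v"
  shows "\<exists>G' :: ('a + nat) graph. simple_graph G' \<and> card (edges G') = card (edges G) \<and>
    num_cycles G < num_cycles G'"
proof -
  let ?d = "degree G v" and ?N = "{u. {u, v} \<in> edges G}"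
  let ?U = "{H \<in> cycles G. v \<notin> verts H}" and ?V = "{H \<in> cycles G. v \<in> verts H}"
  have "bij_betw (\<lambda>u. {u, v}) ?N {e \<in> edges G. v \<in> e}"
    unfolding bij_betw_def
  proof
    show "inj_on (\<lambda>u. {u, v}) ?N"
      by (auto simp: inj_on_def doubleton_eq_iff)
    have "\<exists>u. e = {u, v}" if "e \<in> edges G" "v \<in> e" for e
    proof -
      have "card e = 2" using G that(1) by (auto simp: simple_graph_def)
      then show ?thesis using that(2) by (auto simp: card_2_iff)
    qed
    then show "(\<lambda>u. {u, v}) ` ?N = {e \<in> edges G. v \<in> e}"
      by auto
  qed
  then have "card ?N = ?d"
    unfolding degree_def by (rule bij_betw_same_card)
  moreover have finN: "finite ?N"
    using d \<open>card ?N = ?d\<close> by (intro card_ge_0_finite) auto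
  ultimately obtain idx where idx: "bij_betw idx ?N {..<?d}"
    using ex_bij_betw_finite_nat[OF finN] by (auto simp: atLeast0LessThan)
  have "\<exists>xs. traverses v xs H" if "H \<in> ?V" for H
    using cycle_through_vertex[of H v] that by (auto simp: cycles_def traverses_def)
  \<comment> \<open>One of the two orientations is fixed for each cycle, so that no cycle is counted
    twice.\<close>
  then obtain rep where rep: "\<And>H. H \<in> ?V \<Longrightarrow> traverses v (rep H) H"
    by metis
  have ends: "idx (last (rep H)) \<in> {..<?d} \<and> idx (hd (rep H)) \<in> {..<?d} \<and>
      idx (last (rep H)) \<noteq> idx (hd (rep H))" if H: "H \<in> ?V" for H
  proof -
    have "edges H \<subseteq> edges G"
      using H by (auto simp: cycles_def subgraph_def)
    then have N: "last (rep H) \<in> ?N" "hd (rep H) \<in> ?N"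
      using traverses_edges[OF rep[OF H]] by auto
    have "last (rep H) \<noteq> hd (rep H)"
      using rep[OF H] by (cases "rep H") (auto simp: traverses_def Suc_le_eq)
    then show ?thesis
      using N bij_betwE[OF idx] inj_onD[OF bij_betw_imp_inj_on[OF idx]] by blast
  qed
  obtain \<sigma> where \<sigma>: "\<sigma> permutes {..<?d}"
    and sum: "card ?V \<le> (\<Sum>H\<in>?V. weight (label (\<sigma> (idx (last (rep H))))) (label (\<sigma> (idx (hd (rep H))))))"
    using ex_permutation_sum_ge[of "{..<?d}" "\<lambda>i j. weight (label i) (label j)" ?V
        "\<lambda>H. idx (last (rep H))" "\<lambda>H. idx (hd (rep H))"] sum_weight_ge[OF d] ends
    by auto
  define \<phi> where "\<phi> = (\<lambda>u. label (\<sigma> (idx u)))"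
  have bij: "bij_betw (\<lambda>u. \<sigma> (idx u)) ?N {..<?d}"
    using bij_betw_trans[OF idx permutes_imp_bij[OF \<sigma>]] by (simp add: comp_def)
  \<comment> \<open>Permuting the labels does not change how many edges are kept.\<close>
  have "bij_betw (\<lambda>u. \<sigma> (idx u)) {u \<in> ?N. \<phi> u < 4} {i \<in> {..<?d}. label i < 4}"
    using bij unfolding bij_betw_def \<phi>_def by (auto intro: inj_on_subset)
  then have "card {u. {u, v} \<in> edges G \<and> \<phi> u < 4} = card {i. i < ?d \<and> label i < 4}"
    by (simp add: bij_betw_same_card)
  then have "card {u. {u, v} \<in> edges G \<and> \<phi> u < 4} + 6 = ?d"
    using card_label_lt_4[OF d] d by simp
  then have "card (edges (replace_K4 v \<phi> G)) = card (edges G)"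
    by (rule card_edges_replace_K4[OF G])
  moreover have "num_cycles G < num_cycles (replace_K4 v \<phi> G)"
  proof -
    have "num_cycles G = card ?U + card ?V"
    proof -
      have "cycles G = ?U \<union> ?V" by blast
      then show ?thesis
        unfolding num_cycles_def using finite_cycles[OF G]
        by (subst card_Un_disjoint[symmetric]) auto
    qed
    also have "card ?V \<le> (\<Sum>H\<in>?V. weight (\<phi> (last (rep H))) (\<phi> (hd (rep H))))"
      using sum unfolding \<phi>_def .
    also have "\<dots> \<le> (\<Sum>H\<in>?V. card (K4_paths (\<phi> (last (rep H))) (\<phi> (hd (rep H)))))"
      by (intro sum_mono weight_le_card_K4_paths)
    finally show ?thesis
      using num_cycles_replace_K4[OF G, of v rep \<phi>] rep by simp
  qed
  ultimately show ?thesis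
    using simple_replace_K4[OF G] by blast
qed

theorem theorem2p1:
  fixes G :: "'a graph" and m :: nat
  assumes "m > 0"
    and "simple_graph G"
    and "card (edges G) = m"
    and "num_cycles G = max_num_cycles m"
  shows "max_degree G \<le> 11"
proof -
  have "degree G v \<le> 11" for v
  proof (rule ccontr)
    assume "\<not> degree G v \<le> 11"
    then obtain G' :: "('a + nat) graph" where "simple_graph G'" "card (edges G') = m"
      "num_cycles G < num_cycles G'"
      using ex_more_cycles[OF assms(2), of v] assms(3) by auto
    then show False
      using num_cycles_le_max[of G'] assms(4) by simp
  qed
  \<comment> \<open>\<open>Max\<close> is only meaningful on a nonempty finite set; an edge, present
    as \<open>m > 0\<close>, supplies a vertex.\<close>
  moreover have "finite (verts G)" "verts G \<noteq> {}"
  proof -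
    show "finite (verts G)"
      using assms(2) by (simp add: simple_graph_def)
    have "edges G \<noteq> {}"
      using assms(1,3) by auto
    then show "verts G \<noteq> {}"
      using assms(2) by (fastforce simp: simple_graph_def)
  qed
  ultimately show ?thesis
    by (simp add: max_degree_def)
qed

end
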